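(* Let $n\ge0$ be an integer. For every $k=1,\dots,n+1$ the following identities hold (the first and third for all real $x$): $$\tilde\ell_k(x)=\tilde\lambda_k\,\tilde K_n(w,x,\tilde x_k),\qquad \tilde\lambda_k=\left[\tilde K_n(w,\tilde x_k,\tilde x_k)\right]^{-1},\qquad \tilde\ell_k(x)=\frac{\tilde K_n(w,x,\tilde x_k)}{\tilde K_n(w,\tilde x_k,\tilde x_k)}.$$ Consequently, for every continuous function $f$ defined on $[a,b]$, the anti-Gauss Lagrange polynomial interpolating $f$ is given by $$\tilde L_{n+1}(f,x)=\sum_{k=1}^{n+1}\tilde\lambda_k\,\tilde K_n(w,x,\tilde x_k)\,f(\tilde x_k).$$
   Context: Let $w$ be a weight function on an interval $[a,b]$ (nonnegative, with positive integral and finite moments of all orders), and let $\langle f,g\rangle_w=\int_a^b f(x)g(x)w(x)\,dx$. Let $\{p_n\}_{n\ge0}$ be the sequence of monic orthogonal polynomials with respect to $w$ ($\deg p_n=n$, $\langle p_n,p_m\rangle_w=0$ for $n\ne m$), and set $c_n=\langle p_n,p_n\rangle_w>0$. Let $p_n(w,x)=p_n(x)/\sqrt{c_n}$ denote the orthonormal polynomials with positive leading coefficient. For $n\ge0$ the anti-Gauss polynomial of degree $n+1$ is $$\tilde p_{n+1}(x)=2p_{n+1}(x)+(a_n-x)p_n(x),\qquad a_n=\frac{\langle xp_n,p_n\rangle_w}{\langle p_n,p_n\rangle_w}.$$ It is known that its zeros $\tilde x_1,\dots,\tilde x_{n+1}$ are real, distinct and interlace the zeros of $p_n$ (so $p_n(\tilde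 x_k)\ne0$ and $\tilde p_{n+1}'(\tilde x_k)\neq 0$); it is assumed that $w$ is such that they belong to $[a,b]$. The modified Christoffel–Darboux kernel is $$\tilde K_n(w,x,y)=\sum_{j=0}^{n}p_j(w,x)p_j(w,y)-\tfrac12\,p_n(w,x)p_n(w,y).$$ The Christoffel numbers of the anti-Gauss formula are $$\tilde\lambda_k=\frac{2c_n}{p_n(\tilde x_k)\,\tilde p_{n+1}'(\tilde x_k)},\qquad k=1,\dots,n+1.$$ The anti-Gauss Lagrange polynomial of $f$ is $$\tilde L_{n+1}(f,x)=\sum_{k=1}^{n+1}\tilde\ell_k(x)f(\tilde x_k),\qquad \tilde\ell_k(x)=\prod_{j=1,\,j\ne k}^{n+1}\frac{x-\tilde x_j}{\tilde x_k-\tilde x_j}.$$ *)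

theory Defs
  imports "HOL-Analysis.Analysis" "HOL-Computational_Algebra.Polynomial"
begin

definition weight_function :: "real \<Rightarrow> real \<Rightarrow> (real \<Rightarrow> real) \<Rightarrow> bool" where
  "weight_function a b w \<longleftrightarrow>
     a < b \<and>
     (\<forall>x\<in>{a..b}. 0 \<le> w x) \<and>
     (\<forall>m::nat. set_integrable lebesgue {a..b} (\<lambda>x. x ^ m * w x)) \<and>
     0 < (LINT x:{a..b}|lebesgue. w x)"

definition w_inner ::
  "real \<Rightarrow> real \<Rightarrow> (real \<Rightarrow> real) \<Rightarrow> (real \<Rightarrow> real) \<Rightarrow> (real \<Rightarrow> real) \<Rightarrow> real" where
  "w_inner a b w f g = (LINT x:{a..b}|lebesgue. f x * g x * w x)"

definition monic_orthogonal ::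
  "real \<Rightarrow> real \<Rightarrow> (real \<Rightarrow> real) \<Rightarrow> (nat \<Rightarrow> real poly) \<Rightarrow> bool" where
  "monic_orthogonal a b w p \<longleftrightarrow>
     (\<forall>n. degree (p n) = n \<and> lead_coeff (p n) = 1) \<and>
     (\<forall>n m. n \<noteq> m \<longrightarrow> w_inner a b w (poly (p n)) (poly (p m)) = 0)"

definition sq_norm ::
  "real \<Rightarrow> real \<Rightarrow> (real \<Rightarrow> real) \<Rightarrow> (nat \<Rightarrow> real poly) \<Rightarrow> nat \<Rightarrow> real" where
  "sq_norm a b w p n = w_inner a b w (poly (p n)) (poly (p n))"

definition orthonormal ::
  "real \<Rightarrow> real \<Rightarrow> (real \<Rightarrow> real) \<Rightarrow> (nat \<Rightarrow> real poly) \<Rightarrow> nat \<Rightarrow> real \<Rightarrow> real" where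
  "orthonormal a b w p n x = poly (p n) x / sqrt (sq_norm a b w p n)"

definition rec_coeff ::
  "real \<Rightarrow> real \<Rightarrow> (real \<Rightarrow> real) \<Rightarrow> (nat \<Rightarrow> real poly) \<Rightarrow> nat \<Rightarrow> real" where
  "rec_coeff a b w p n =
     w_inner a b w (\<lambda>x. x * poly (p n) x) (poly (p n)) /
     w_inner a b w (poly (p n)) (poly (p n))"

text \<open>The index is shifted: \<open>anti_gauss_poly a b w p n\<close> has degree \<open>n + 1\<close>; the factor
  \<open>[:c, -1:]\<close> is the polynomial \<open>c - x\<close>.\<close>

definition anti_gauss_poly ::
  "real \<Rightarrow> real \<Rightarrow> (real \<Rightarrow> real) \<Rightarrow> (nat \<Rightarrow> real poly) \<Rightarrow> nat \<Rightarrow> real poly" where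
  "anti_gauss_poly a b w p n =
     smult 2 (p (n + 1)) + [:rec_coeff a b w p n, -1:] * p n"

definition mod_kernel ::
  "real \<Rightarrow> real \<Rightarrow> (real \<Rightarrow> real) \<Rightarrow> (nat \<Rightarrow> real poly) \<Rightarrow> nat \<Rightarrow> real \<Rightarrow> real \<Rightarrow> real" where
  "mod_kernel a b w p n x y =
     (\<Sum>j=0..n. orthonormal a b w p j x * orthonormal a b w p j y)
     - 1 / 2 * orthonormal a b w p n x * orthonormal a b w p n y"

text \<open>In the following, \<open>t 1, \<dots>, t (n + 1)\<close> are the nodes, that is, the zeros of
  \<open>anti_gauss_poly a b w p n\<close>; other values of \<open>t\<close> are irrelevant.\<close>

definition anti_gauss_christoffel ::
  "real \<Rightarrow> real \<Rightarrow> (real \<Rightarrow> real) \<Rightarrow> (nat \<Rightarrow> real poly) \<Rightarrow> nat \<Rightarrow> (nat \<Rightarrow> real) \<Rightarrow> nat \<Rightarrow> real" where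
  "anti_gauss_christoffel a b w p n t k =
     2 * sq_norm a b w p n /
     (poly (p n) (t k) * poly (pderiv (anti_gauss_poly a b w p n)) (t k))"

definition lagrange_basis :: "nat \<Rightarrow> (nat \<Rightarrow> real) \<Rightarrow> nat \<Rightarrow> real \<Rightarrow> real" where
  "lagrange_basis n t k x = (\<Prod>j\<in>{1..n+1} - {k}. (x - t j) / (t k - t j))"

definition lagrange_interp :: "nat \<Rightarrow> (nat \<Rightarrow> real) \<Rightarrow> (real \<Rightarrow> real) \<Rightarrow> real \<Rightarrow> real" where
  "lagrange_interp n t f x = (\<Sum>k=1..n+1. lagrange_basis n t k x * f (t k))"

end

theory Submission
  imports Defs
begin

text \<open>
  Write \<open>K\<close> for the modified kernel, \<open>q = 2 p\<^bsub>n+1\<^esub> + (a\<^sub>n - x) p\<^sub>n\<close> for the anti-Gauss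
  polynomial and \<open>c\<^sub>n\<close> for the squared norm of \<open>p\<^sub>n\<close>. Halving the last summand of the
  Christoffel-Darboux kernel has the effect of replacing \<open>2 p\<^bsub>n+1\<^esub>\<close> by \<open>q\<close> in the
  Christoffel-Darboux identity:

  \<open>(x - y) K(x, y) = (q(x) p\<^sub>n(y) - p\<^sub>n(x) q(y)) / (2 c\<^sub>n)\<close>.

  (The term \<open>- x p\<^sub>n\<close> of \<open>q\<close> accounts for the halved summand, and the term \<open>a\<^sub>n p\<^sub>n\<close> cancels
  by antisymmetry.) This is the lemma \<open>anti_gauss_Christoffel_Darboux\<close>. Everything follows from
  it by putting \<open>y = t\<^sub>k\<close>, a zero of \<open>q\<close>:

  \<^item> At \<open>x = t\<^sub>j\<close> with \<open>j \<noteq> k\<close> the right-hand side vanishes, so \<open>K(t\<^sub>j, t\<^sub>k) = 0\<close>. On the diagonal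
    \<open>K\<close> is a sum of squares and positive. Hence \<open>K(x, t\<^sub>k) / K(t\<^sub>k, t\<^sub>k)\<close> is a polynomial in \<open>x\<close>
    of degree at most \<open>n\<close> with the values of the \<open>k\<close>-th Lagrange basis polynomial at the \<open>n + 1\<close>
    nodes, and so equals it.

  \<^item> Differentiating in \<open>x\<close> at \<open>x = t\<^sub>k\<close> gives
    \<open>K(t\<^sub>k, t\<^sub>k) = p\<^sub>n(t\<^sub>k) q'(t\<^sub>k) / (2 c\<^sub>n)\<close>, the reciprocal of the Christoffel number
    (lemma \<open>anti_gauss_kernel_diagonal\<close>).

  The weight enters only through the positive definite functional
  \<open>f \<mapsto> \<integral> f w\<close> on polynomials, so the algebra is carried out for an arbitrary
  functional of this kind. The Christoffel-Darboux identity rests on the three-term recurrence.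
\<close>

section \<open>Orthogonal polynomials for a positive definite functional\<close>

locale orthogonal_polynomials =
  fixes M :: "real poly \<Rightarrow> real" and p :: "nat \<Rightarrow> real poly"
  assumes M_add: "M (f + g) = M f + M g"
    and M_smult: "M (smult c f) = c * M f"
    and M_square_pos: "f \<noteq> 0 \<Longrightarrow> 0 < M (f * f)"
    and degree_p: "degree (p n) = n"
    and monic_p: "lead_coeff (p n) = 1"
    and orthogonal: "n \<noteq> m \<Longrightarrow> M (p n * p m) = 0"
begin

abbreviation c :: "nat \<Rightarrow> real" where "c n \<equiv> M (p n * p n)"

lemma M_diff: "M (f - g) = M f - M g"
  using M_add[of f "smult (-1) g"] M_smult[of "-1" g] by simp

lemma M_0: "M 0 = 0"
  using M_smult[of 0 0] by simp

lemma p_0: "p 0 = 1"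
  using degree_p[of 0] monic_p[of 0] by (metis degree_0_id of_nat_1 of_nat_poly one_pCons)

lemma p_nonzero: "p n \<noteq> 0"
  using monic_p[of n] by auto

lemma sq_norm_pos: "0 < c n"
  by (rule M_square_pos[OF p_nonzero])

text \<open>One step of the expansion of a polynomial in the basis \<open>p 0, p 1, \<dots>\<close>.\<close>

lemma degree_reduce:
  assumes "degree r \<le> Suc m"
  shows "degree (r - smult (coeff r (Suc m)) (p (Suc m))) \<le> m"
proof (rule degree_le, intro allI impI)
  fix i assume "m < i"
  then consider "i = Suc m" | "Suc m < i" by linarith
  then show "coeff (r - smult (coeff r (Suc m)) (p (Suc m))) i = 0"
  proof cases
    case 1
    then show ?thesis using monic_p[of "Suc m"] degree_p[of "Suc m"] by simp
  next
    case 2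
    then show ?thesis using assms degree_p[of "Suc m"] by (simp add: coeff_eq_0)
  qed
qed

text \<open>The polynomials \<open>p 0, \<dots>, p m\<close> span all polynomials of degree at most \<open>m\<close>; the induction
  on \<open>m\<close> removes the leading term of \<open>r\<close>.\<close>

lemma orthogonal_to_degree_le:
  assumes "\<And>j. j \<le> m \<Longrightarrow> M (s * p j) = 0" and "degree r \<le> m"
  shows "M (s * r) = 0"
  using assms
proof (induction m arbitrary: r)
  case 0
  then obtain d where "r = [:d:]" using degree_eq_zeroE by blast
  then show ?case using "0.prems"(1)[of 0] by (simp add: p_0 M_smult)
next
  case (Suc m)
  let ?d = "coeff r (Suc m)"
  have "M (s * (r - smult ?d (p (Suc m)))) = 0"
    by (rule Suc.IH) (use Suc.prems degree_reduce in auto)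
  moreover have "s * (r - smult ?d (p (Suc m))) = s * r - smult ?d (s * p (Suc m))"
    by (simp add: algebra_simps)
  ultimately show ?case using Suc.prems(1)[of "Suc m"] by (simp add: M_diff M_smult)
qed

lemma orthogonal_lower_degree:
  assumes "degree r < n"
  shows "M (p n * r) = 0"
proof (rule orthogonal_to_degree_le)
  show "degree r \<le> n - 1" using assms by simp
  show "\<And>j. j \<le> n - 1 \<Longrightarrow> M (p n * p j) = 0" using assms by (intro orthogonal) linarith
qed

lemma inner_monic:
  assumes "degree r = n" "lead_coeff r = 1"
  shows "M (p n * r) = c n"
proof (cases n)
  case 0
  then have "r = 1" using assms by (metis degree_0_id of_nat_1 of_nat_poly one_pCons)
  then show ?thesis using 0 by (simp add: p_0)
next
  case (Suc m)
  then have "degree (r - smult 1 (p n)) \<le> m"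
    using degree_reduce[of r m] assms by simp
  then have "M (p n * (r - p n)) = 0"
    using orthogonal_lower_degree[of "r - p n" n] Suc by simp
  then show ?thesis by (simp add: right_diff_distrib M_diff)
qed

lemma degree_lead_coeff_X_mult: "degree ([:0, 1:] * p n) = Suc n" "lead_coeff ([:0, 1:] * p n) = 1"
  using degree_p[of n] monic_p[of n] p_nonzero[of n] by (simp_all add: degree_pCons_eq)

text \<open>The difference \<open>s\<close> of the two sides has degree at most \<open>n\<close>, because the leading terms of
  \<open>x p\<^sub>n\<close> and \<open>p\<^bsub>n+1\<^esub>\<close> cancel. Moving the factor \<open>x\<close> across the inner product,
  \<open>\<langle>x p\<^sub>n, p\<^sub>j\<rangle> = \<langle>p\<^sub>n, x p\<^sub>j\<rangle>\<close>, shows that \<open>s\<close> is orthogonal to \<open>p 0, \<dots>, p n\<close>: the product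
  is \<open>0\<close> for \<open>j < n - 1\<close> and \<open>c n\<close> for \<open>j = n - 1\<close>, since \<open>x p\<^sub>j\<close> is then monic of degree \<open>n\<close>;
  the last term of the recurrence takes this value away, while the coefficient of \<open>p n\<close> is chosen to settle \<open>j = n\<close>. Thus \<open>s\<close> is orthogonal to itself.\<close>

lemma three_term_recurrence:
  defines "\<alpha> \<equiv> (\<lambda>n. M ([:0, 1:] * p n * p n) / c n)"
  shows "[:0, 1:] * p n = p (Suc n) + smult (\<alpha> n) (p n)
           + (if n = 0 then 0 else smult (c n / c (n - 1)) (p (n - 1)))"
proof -
  define L where "L = (if n = 0 then 0 else smult (c n / c (n - 1)) (p (n - 1)))"
  define s where "s = [:0, 1:] * p n - p (Suc n) - smult (\<alpha> n) (p n) - L"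
  have "degree ([:0, 1:] * p n - p (Suc n)) \<le> n"
    using degree_reduce[of "[:0, 1:] * p n" n] degree_lead_coeff_X_mult[of n] by simp
  moreover have "degree L \<le> n" by (simp add: L_def degree_p)
  moreover have "degree (smult (\<alpha> n) (p n)) \<le> n" by (simp add: degree_p)
  ultimately have deg_s: "degree s \<le> n"
    unfolding s_def by (metis degree_diff_le)
  have "M (s * p j) = 0" if "j \<le> n" for j
  proof -
    have s_p: "M (s * p j) = M ([:0, 1:] * p n * p j) - \<alpha> n * M (p n * p j) - M (L * p j)"
      using orthogonal[of "Suc n" j] that
      by (simp only: s_def left_diff_distrib M_diff mult_smult_left M_smult)
    have shift: "[:0, 1:] * p n * p j = p n * ([:0, 1:] * p j)"
      by (simp only: mult.assoc mult.left_commute)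
    consider "j = n" | "Suc j = n" | "Suc j < n" using \<open>j \<le> n\<close> by linarith
    then show ?thesis
    proof cases
      case 1
      have "M (L * p n) = 0"
        using orthogonal[of "n - 1" n] by (simp add: L_def M_0 M_smult)
      then show ?thesis using s_p 1 sq_norm_pos[of n] by (simp add: \<alpha>_def)
    next
      case 2
      have "M ([:0, 1:] * p n * p j) = c n"
        unfolding shift by (rule inner_monic) (use degree_lead_coeff_X_mult[of j] 2 in auto)
      moreover have "M (L * p j) = c n"
        using 2 sq_norm_pos[of j] by (auto simp: L_def M_smult)
      ultimately show ?thesis using s_p orthogonal[of n j] 2 by simp
    next
      case 3
      have "M ([:0, 1:] * p n * p j) = 0"
        unfolding shift by (rule orthogonal_lower_degree) (use degree_lead_coeff_X_mult[of j] 3 in auto)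
      moreover have "M (L * p j) = 0"
        using 3 orthogonal[of "n - 1" j] by (simp add: L_def M_smult M_0)
      ultimately show ?thesis using s_p orthogonal[of n j] 3 by simp
    qed
  qed
  then have "M (s * s) = 0" using orthogonal_to_degree_le deg_s by blast
  then have "s = 0" using M_square_pos[of s] by fastforce
  then show ?thesis by (simp add: s_def L_def algebra_simps)
qed

text \<open>By induction on \<open>n\<close>: after the recurrence is applied to \<open>p\<^bsub>n+2\<^esub>\<close> at both points, the
  terms with the coefficient of \<open>p\<^bsub>n+1\<^esub>\<close> cancel by antisymmetry, the terms with \<open>x\<close> and \<open>y\<close> give the new summand, and
  the terms with \<open>c (n + 1) / c n\<close> reproduce the identity for \<open>n\<close>.\<close>

lemma Christoffel_Darboux:
  "(x - y) * (\<Sum>j=0..n. poly (p j) x * poly (p j) y / c j)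
     = (poly (p (Suc n)) x * poly (p n) y - poly (p n) x * poly (p (Suc n)) y) / c n"
proof -
  define \<alpha> where "\<alpha> n = M ([:0, 1:] * p n * p n) / c n" for n
  have rec: "z * poly (p n) z = poly (p (Suc n)) z + \<alpha> n * poly (p n) z
               + (if n = 0 then 0 else c n / c (n - 1) * poly (p (n - 1)) z)" for n z
    using arg_cong[OF three_term_recurrence[of n], of "\<lambda>r. poly r z"]
    by (simp add: \<alpha>_def split: if_splits)
  show ?thesis
  proof (induction n)
    case 0
    have "x - y = poly (p (Suc 0)) x - poly (p (Suc 0)) y"
      using rec[of x 0] rec[of y 0] by (simp add: p_0)
    then show ?case by (simp add: p_0)
  next
    case (Suc n)
    let ?P = "\<lambda>m. poly (p m)"
    have px: "?P (Suc (Suc n)) x = (x - \<alpha> (Suc n)) * ?P (Suc n) x - c (Suc n) / c n * ?P n x"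
      and py: "?P (Suc (Suc n)) y = (y - \<alpha> (Suc n)) * ?P (Suc n) y - c (Suc n) / c n * ?P n y"
      using rec[of x "Suc n"] rec[of y "Suc n"] by (simp_all add: algebra_simps)
    show ?case
      unfolding sum.atLeast0_atMost_Suc distrib_left Suc px py
      using sq_norm_pos[of n] sq_norm_pos[of "Suc n"] by (simp add: field_simps)
  qed
qed

section \<open>The modified kernel\<close>

text \<open>The kernel \<open>K(x, y)\<close> as a polynomial in \<open>x\<close>, so that degrees and formal derivatives
  are available.\<close>

definition anti_gauss_kernel :: "nat \<Rightarrow> real \<Rightarrow> real poly" where
  "anti_gauss_kernel n y = (\<Sum>j=0..n. smult (poly (p j) y / c j) (p j))
                  - smult (poly (p n) y / (2 * c n)) (p n)"

lemma degree_anti_gauss_kernel: "degree (anti_gauss_kernel n y) \<le> n"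
  unfolding anti_gauss_kernel_def
  by (intro degree_diff_le degree_sum_le order.trans[OF degree_smult_le])
     (simp_all add: degree_p)

text \<open>All summands are squares with nonnegative weights, and the one with \<open>j = 0\<close> is positive
  because \<open>p 0 = 1\<close>. For \<open>n = 0\<close> this is the halved summand, so that case is separate.\<close>

lemma anti_gauss_kernel_diagonal_pos: "0 < poly (anti_gauss_kernel n y) y"
proof -
  have nonneg: "0 \<le> poly (p j) y * poly (p j) y / c j" for j
    using sq_norm_pos[of j] by simp
  have eq: "poly (anti_gauss_kernel n y) y = (\<Sum>j=0..<n. poly (p j) y * poly (p j) y / c j)
               + poly (p n) y * poly (p n) y / (2 * c n)"
    by (simp add: anti_gauss_kernel_def poly_sum atLeast0AtMost atLeast0LessThan
        flip: lessThan_Suc_atMost)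
  show ?thesis
  proof (cases n)
    case 0
    then show ?thesis using eq sq_norm_pos[of 0] by (simp add: p_0)
  next
    case (Suc m)
    have "0 < (\<Sum>j=0..<n. poly (p j) y * poly (p j) y / c j)"
      by (rule sum_pos2[of _ 0]) (use Suc sq_norm_pos[of 0] nonneg in \<open>auto simp: p_0\<close>)
    moreover have "0 \<le> poly (p n) y * poly (p n) y / (2 * c n)"
      using sq_norm_pos[of n] by simp
    ultimately show ?thesis using eq by linarith
  qed
qed

text \<open>The halved summand subtracts \<open>(x - y) p\<^sub>n(x) p\<^sub>n(y) / (2 c\<^sub>n)\<close> from the Christoffel-Darboux
  identity, which is exactly what the term \<open>- x p\<^sub>n\<close> of \<open>q\<close> contributes. The constant \<open>\<beta>\<close> cancels,
  hence it is arbitrary.\<close>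

lemma anti_gauss_Christoffel_Darboux:
  fixes \<beta> x y :: real and n :: nat
  defines "q \<equiv> smult 2 (p (Suc n)) + [:\<beta>, -1:] * p n"
  shows "(x - y) * poly (anti_gauss_kernel n y) x
           = (poly q x * poly (p n) y - poly (p n) x * poly q y) / (2 * c n)"
proof -
  let ?S = "\<Sum>j=0..n. poly (p j) x * poly (p j) y / c j"
  have "poly (anti_gauss_kernel n y) x = ?S - poly (p n) x * poly (p n) y / (2 * c n)"
    by (simp add: anti_gauss_kernel_def poly_sum mult.commute)
  then have "(x - y) * poly (anti_gauss_kernel n y) x
      = (x - y) * ?S - (x - y) * (poly (p n) x * poly (p n) y / (2 * c n))"
    by (simp only: right_diff_distrib)
  also have "\<dots> = (poly q x * poly (p n) y - poly (p n) x * poly q y) / (2 * c n)"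
    unfolding Christoffel_Darboux using sq_norm_pos[of n] by (simp add: q_def field_simps)
  finally show ?thesis .
qed

text \<open>The confluent form of the identity at a zero \<open>y\<close> of \<open>q\<close>, where it reads
  \<open>(x - y) K(x, y) = p\<^sub>n(y) q(x) / (2 c\<^sub>n)\<close>: the derivative of the left-hand side at \<open>x = y\<close>
  is \<open>K(y, y)\<close>.\<close>

lemma anti_gauss_kernel_diagonal:
  fixes \<beta> y :: real and n :: nat
  defines "q \<equiv> smult 2 (p (Suc n)) + [:\<beta>, -1:] * p n"
  assumes "poly q y = 0"
  shows "poly (anti_gauss_kernel n y) y = poly (p n) y * poly (pderiv q) y / (2 * c n)"
proof -
  have "[:- y, 1:] * anti_gauss_kernel n y = smult (poly (p n) y / (2 * c n)) q"
    using anti_gauss_Christoffel_Darboux[of _ y n \<beta>, folded q_def] assms(2)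
    by (intro poly_ext) (simp add: algebra_simps)
  from arg_cong[OF this, of "\<lambda>r. poly (pderiv r) y"] show ?thesis
    by (simp add: pderiv_mult pderiv_smult pderiv_pCons del: mult_pCons_left)
qed

end

section \<open>Lagrange interpolation\<close>

text \<open>Two polynomials of degree at most \<open>n\<close> that agree at \<open>n + 1\<close> distinct nodes are equal.\<close>

lemma lagrange_basis_unique:
  assumes "inj_on t {1..n+1}" and "k \<in> {1..n+1}" and "degree r \<le> n"
    and "\<And>j. j \<in> {1..n+1} \<Longrightarrow> poly r (t j) = (if j = k then 1 else 0)"
  shows "lagrange_basis n t k x = poly r x"
proof -
  define l where "l = (\<Prod>j\<in>{1..n+1} - {k}. smult (1 / (t k - t j)) [:- t j, 1:])"
  have l: "poly l z = lagrange_basis n t k z" for z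
    by (simp add: l_def lagrange_basis_def poly_prod diff_divide_distrib)
  have factor: "degree (smult (1 / (t k - t j)) [:- t j, 1:]) \<le> 1" for j
    by (rule order.trans[OF degree_smult_le]) simp
  have "degree l \<le> (\<Sum>j\<in>{1..n+1} - {k}. 1)"
    unfolding l_def using factor
    by (intro order.trans[OF degree_prod_sum_le] sum_mono) (simp_all only: o_def finite_Diff finite_atLeastAtMost)
  also have "\<dots> = n" using assms(2) by simp
  finally have "degree l \<le> n" .
  have "l = r"
  proof (rule poly_eqI_degree[of "t ` {1..n+1}"])
    have card: "card (t ` {1..n+1}) = n + 1" using card_image[OF assms(1)] by simp
    show "degree l < card (t ` {1..n+1})" using card \<open>degree l \<le> n\<close> by linarith
    show "degree r < card (t ` {1..n+1})" using card \<open>degree r \<le> n\<close> by linarith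
    fix z assume "z \<in> t ` {1..n+1}"
    then obtain j where j: "j \<in> {1..n+1}" "z = t j" by blast
    have "lagrange_basis n t k (t j) = (if j = k then 1 else 0)"
    proof (cases "j = k")
      case True
      have "t k \<noteq> t i" if "i \<in> {1..n+1} - {k}" for i
        using inj_onD[OF assms(1)] assms(2) that by blast
      with True show ?thesis unfolding lagrange_basis_def by (simp add: prod.neutral)
    next
      case False
      then show ?thesis
        using j by (auto simp: lagrange_basis_def intro!: prod_zero)
    qed
    then show "poly l z = poly r z" using assms(4)[OF j(1)] j(2) l by simp
  qed
  then show ?thesis using l by simp
qed

section \<open>The functional given by a weight function\<close>

definition moment_functional ::
  "real \<Rightarrow> real \<Rightarrow> (real \<Rightarrow> real) \<Rightarrow> real poly \<Rightarrow> real" where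
  "moment_functional a b w r = (LINT x:{a..b}|lebesgue. poly r x * w x)"

lemma set_integrable_poly_weight:
  assumes "weight_function a b w"
  shows "set_integrable lebesgue {a..b} (\<lambda>x. poly r x * w x)"
proof -
  have "set_integrable lebesgue {a..b} (\<lambda>x. coeff r i * (x ^ i * w x))" for i
    using assms by (simp add: weight_function_def)
  then have "set_integrable lebesgue {a..b} (\<lambda>x. \<Sum>i\<le>degree r. coeff r i * (x ^ i * w x))"
    unfolding set_integrable_def scaleR_sum_right by (intro Bochner_Integration.integrable_sum)
  then show ?thesis by (simp add: poly_altdef sum_distrib_right mult.assoc)
qed

text \<open>A vanishing integral of \<open>r\<^sup>2 w \<ge> 0\<close> would force \<open>r\<^sup>2 w = 0\<close> almost everywhere on the
  interval. The finitely many zeros of \<open>r\<close> form a null set, so \<open>w = 0\<close> almost everywhere, contrary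
  to the positive integral of the weight.\<close>

lemma moment_functional_square_pos:
  assumes w: "weight_function a b w" and "r \<noteq> 0"
  shows "0 < moment_functional a b w (r * r)"
proof -
  let ?I = "\<lambda>f x. indicator {a..b} x *\<^sub>R (f x :: real)"
  let ?g = "\<lambda>x. poly (r * r) x * w x"
  have int: "integrable lebesgue (?I ?g)"
    using set_integrable_poly_weight[OF w, of "r * r"] by (simp add: set_integrable_def)
  have nonneg: "0 \<le> ?I ?g x" for x
    using w by (auto simp: weight_function_def indicator_def)
  have "moment_functional a b w (r * r) \<noteq> 0"
  proof
    assume "moment_functional a b w (r * r) = 0"
    then have "AE x in lebesgue. ?I ?g x = 0"
      using integral_nonneg_eq_0_iff_AE[OF int] nonneg
      by (simp add: moment_functional_def set_lebesgue_integral_def)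
    moreover have "AE x in lebesgue. poly r x \<noteq> 0"
    proof (rule AE_I')
      show "{x. poly r x = 0} \<in> null_sets lebesgue"
        using poly_roots_finite[OF \<open>r \<noteq> 0\<close>]
        by (metis finite_imp_null_set_lborel null_sets_completionI)
    qed auto
    ultimately have "AE x in lebesgue. ?I w x = 0"
      by eventually_elim auto
    then have "(LINT x:{a..b}|lebesgue. w x) = 0"
      unfolding set_lebesgue_integral_def by (rule integral_eq_zero_AE)
    then show False using w by (simp add: weight_function_def)
  qed
  moreover have "0 \<le> moment_functional a b w (r * r)"
    unfolding moment_functional_def set_lebesgue_integral_def
    using nonneg by (rule Bochner_Integration.integral_nonneg)
  ultimately show ?thesis by linarith
qed

lemma w_inner_poly:
  "w_inner a b w (poly f) (poly g) = moment_functional a b w (f * g)"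
  by (simp add: w_inner_def moment_functional_def)

lemma orthogonal_polynomials_moment_functional:
  assumes w: "weight_function a b w" and p: "monic_orthogonal a b w p"
  shows "orthogonal_polynomials (moment_functional a b w) p"
proof
  show "moment_functional a b w (f + g) = moment_functional a b w f + moment_functional a b w g"
    for f g
    unfolding moment_functional_def poly_add distrib_right
    by (rule set_integral_add) (rule set_integrable_poly_weight[OF w])+
  show "moment_functional a b w (smult c f) = c * moment_functional a b w f" for c f
    by (simp add: moment_functional_def mult.assoc)
  show "0 < moment_functional a b w (f * f)" if "f \<noteq> 0" for f
    by (rule moment_functional_square_pos[OF w that])
  show "degree (p n) = n" "lead_coeff (p n) = 1" for n
    using p unfolding monic_orthogonal_def by blast+
  show "moment_functional a b w (p n * p m) = 0" if "n \<noteq> m" for n m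
    using p that by (auto simp: monic_orthogonal_def w_inner_poly)
qed

section \<open>The anti-Gauss Lagrange polynomial\<close>

theorem theorem2p2:
  fixes a b :: real and w :: "real \<Rightarrow> real" and p :: "nat \<Rightarrow> real poly"
    and n :: nat and t :: "nat \<Rightarrow> real"
  assumes "weight_function a b w"
    and "monic_orthogonal a b w p"
    and "bij_betw t {1..n+1} {x. poly (anti_gauss_poly a b w p n) x = 0}"
    and "\<forall>k\<in>{1..n+1}. t k \<in> {a..b}"
  shows "(\<forall>k\<in>{1..n+1}.
           (\<forall>x. lagrange_basis n t k x
              = anti_gauss_christoffel a b w p n t k * mod_kernel a b w p n x (t k)) \<and>
           anti_gauss_christoffel a b w p n t k = inverse (mod_kernel a b w p n (t k) (t k)) \<and>
           (\<forall>x. lagrange_basis n t k x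
              = mod_kernel a b w p n x (t k) / mod_kernel a b w p n (t k) (t k))) \<and>
         (\<forall>f. continuous_on {a..b} f \<longrightarrow>
           (\<forall>x. lagrange_interp n t f x
              = (\<Sum>k=1..n+1. anti_gauss_christoffel a b w p n t k
                              * mod_kernel a b w p n x (t k) * f (t k))))"
proof -
  interpret orthogonal_polynomials "moment_functional a b w" p
    using orthogonal_polynomials_moment_functional assms(1,2) .
  let ?q = "anti_gauss_poly a b w p n"
  have q: "?q = smult 2 (p (Suc n)) + [:rec_coeff a b w p n, -1:] * p n"
    by (simp add: anti_gauss_poly_def)
  have norm: "sq_norm a b w p j = c j" for j
    by (simp add: sq_norm_def w_inner_poly)
  have "orthonormal a b w p j x * orthonormal a b w p j y = poly (p j) x * poly (p j) y / c j"
    for j x y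
    using sq_norm_pos[of j] by (simp add: orthonormal_def norm)
  then have K: "mod_kernel a b w p n x y = poly (anti_gauss_kernel n y) x" for x y
    by (simp add: mod_kernel_def anti_gauss_kernel_def poly_sum mult.commute mult.assoc)
  have root: "poly ?q (t k) = 0" if "k \<in> {1..n+1}" for k
    using bij_betw_apply[OF assms(3) that] by simp
  have inj: "inj_on t {1..n+1}" using assms(3) by (rule bij_betw_imp_inj_on)
  have christoffel: "anti_gauss_christoffel a b w p n t k = inverse (mod_kernel a b w p n (t k) (t k))"
    if "k \<in> {1..n+1}" for k
    using anti_gauss_kernel_diagonal[of n "rec_coeff a b w p n" "t k", folded q] root[OF that]
    by (simp add: anti_gauss_christoffel_def norm K)
  have basis: "lagrange_basis n t k x = mod_kernel a b w p n x (t k) / mod_kernel a b w p n (t k) (t k)"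
    if k: "k \<in> {1..n+1}" for k x
  proof -
    let ?d = "poly (anti_gauss_kernel n (t k)) (t k)"
    have "?d \<noteq> 0" using anti_gauss_kernel_diagonal_pos[of n "t k"] by simp
    have "poly (anti_gauss_kernel n (t k)) (t j) = 0" if "j \<in> {1..n+1}" "j \<noteq> k" for j
    proof -
      have "t j \<noteq> t k" using inj_onD[OF inj] that k by blast
      then show ?thesis
        using anti_gauss_Christoffel_Darboux[of "t j" "t k" n "rec_coeff a b w p n", folded q]
          root k that by simp
    qed
    then have "lagrange_basis n t k x = poly (smult (1 / ?d) (anti_gauss_kernel n (t k))) x"
      using \<open>?d \<noteq> 0\<close> degree_anti_gauss_kernel[of n "t k"]
      by (intro lagrange_basis_unique[OF inj k]) auto
    then show ?thesis by (simp add: K)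
  qed
  show ?thesis
    using christoffel basis by (simp add: lagrange_interp_def divide_inverse mult.commute)
qed

end
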